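(* Let $(\mathcal{A},\Omega,\Diamond,\mathcal{S})$ be a monadic core. Then in the induced evidenced frame $(\Omega^{\mathcal{A}},\mathcal{S},\cdot\xrightarrow{\cdot}\cdot)$, where $\phi_1\xrightarrow{e}\phi_2:=\forall c\in\mathcal{A}.\ \phi_1(c)\le\Diamond(e\cdot c)(\phi_2)$, there exists evidence $e\in\mathcal{S}$ with $\top\xrightarrow{e}\bot$ if and only if $\mathbf{1}\le\mathbf{0}$ in $\Omega$, where $\top:=\lambda c.\mathbf{1}$ and $\bot:=\lambda c.\mathbf{0}$.
   Context: $M$ is a monad on $\mathbf{Set}$ with unit $\eta$. $\mathcal{A}$ is a monadic combinatory algebra over $M$ (codes with application $\mathcal{A}\times\mathcal{A}\to M\mathcal{A}$ and abstraction codes $\langle\lambda^n.e\rangle$ satisfying combinatory completeness; in particular $\langle\lambda^0.0\rangle\cdot c=\eta(c)$). $(\Omega,\le)$ is a complete Heyting prealgebra with meets $\bigwedge$ (infima), top $\mathbf{1}$, bottom $\mathbf{0}$ and implication $\Rightarrow$. $\Diamond$ is an $M$-modality: natural transformation $\Diamond_X:M(X)\to(X\to\Omega)\to\Omega$ with $\phi(a)\le\Diamond(\eta(a))(\phi)$, $\Diamond(m)(\lambda x.\Diamond(f(x))(\phi))\le\Diamond(\mathrm{bind}(m,f))(\phi)$, and $\bigwedge_c(\phi_1(c)\Rightarrow\phi_2(c))\le\Diamond(m)(\phi_1)\Rightarrow\Diamond(m)(\phi_2)$. $\mathcal{S}\subseteq\mathcal{A}$ is a separator: a combinatorially complete subset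 such that for all $c_f,c_a\in\mathcal{S}$, the progress property $\Diamond(c_f\cdot c_a)(\lambda r.\mathbf{0})\le\mathbf{0}$ holds. *)

theory Defs
  imports Main "HOL-Library.FuncSet"
begin

section \<open>Monads on sets\<close>

text \<open>
  HOL has no type of all sets and cannot quantify over type constructors. The objects of the
  category of sets are therefore the subsets of an arbitrary type \<open>'u\<close>, and a monad is given as a
  Kleisli triple whose value \<open>M X\<close> is a subset of a second arbitrary type \<open>'m\<close>. (Kleisli triples
  never mention \<open>M (M X)\<close>, so \<open>'m\<close> need not embed into \<open>'u\<close>, and e.g. \<open>M = Pow\<close> is an instance.)
  A function \<open>X \<rightarrow> Y\<close> is a HOL function whose values off \<open>X\<close> are irrelevant; the axioms named
  \<open>cong\<close> state that the operations taking such functions as arguments ignore those values.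
\<close>

locale set_monad =
  fixes M :: "'u set \<Rightarrow> 'm set"
    and unit :: "'u set \<Rightarrow> 'u \<Rightarrow> 'm"
    and bind :: "'u set \<Rightarrow> 'u set \<Rightarrow> 'm \<Rightarrow> ('u \<Rightarrow> 'm) \<Rightarrow> 'm"
  assumes unit_closed: "x \<in> X \<Longrightarrow> unit X x \<in> M X"
    and bind_closed: "m \<in> M X \<Longrightarrow> f \<in> X \<rightarrow> M Y \<Longrightarrow> bind X Y m f \<in> M Y"
    and bind_cong: "m \<in> M X \<Longrightarrow> f \<in> X \<rightarrow> M Y \<Longrightarrow> (\<And>x. x \<in> X \<Longrightarrow> f x = g x) \<Longrightarrow>
      bind X Y m f = bind X Y m g"
    and bind_unit_left: "x \<in> X \<Longrightarrow> f \<in> X \<rightarrow> M Y \<Longrightarrow> bind X Y (unit X x) f = f x"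
    and bind_unit_right: "m \<in> M X \<Longrightarrow> bind X X m (unit X) = m"
    and bind_assoc: "m \<in> M X \<Longrightarrow> f \<in> X \<rightarrow> M Y \<Longrightarrow> g \<in> Y \<rightarrow> M Z \<Longrightarrow>
      bind Y Z (bind X Y m f) g = bind X Z m (\<lambda>x. bind Y Z (f x) g)"
begin

definition fmap :: "'u set \<Rightarrow> 'u set \<Rightarrow> ('u \<Rightarrow> 'u) \<Rightarrow> 'm \<Rightarrow> 'm" where
  "fmap X Y f m = bind X Y m (\<lambda>x. unit Y (f x))"

end


section \<open>Monadic combinatory algebras\<close>

text \<open>Variables are de Bruijn indices.\<close>

datatype 'c expr = Var nat | Code 'c | App "'c expr" "'c expr"

inductive_set exprs :: "'c set \<Rightarrow> nat \<Rightarrow> 'c expr set" for C :: "'c set" and n :: nat where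
  "i < n \<Longrightarrow> Var i \<in> exprs C n"
| "c \<in> C \<Longrightarrow> Code c \<in> exprs C n"
| "e\<^sub>f \<in> exprs C n \<Longrightarrow> e\<^sub>a \<in> exprs C n \<Longrightarrow> App e\<^sub>f e\<^sub>a \<in> exprs C n"

text \<open>Substitution of a code for variable 0; the remaining variables are lowered by one, so that
  \<open>exprs C (Suc n)\<close> is mapped to \<open>exprs C n\<close>.\<close>

primrec subst :: "'c expr \<Rightarrow> 'c \<Rightarrow> 'c expr" where
  "subst (Var i) c = (case i of 0 \<Rightarrow> Code c | Suc j \<Rightarrow> Var j)"
| "subst (Code d) c = Code d"
| "subst (App e\<^sub>f e\<^sub>a) c = App (subst e\<^sub>f c) (subst e\<^sub>a c)"

locale monadic_applicative_structure = set_monad M unit bind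
  for M :: "'u set \<Rightarrow> 'm set"
    and unit :: "'u set \<Rightarrow> 'u \<Rightarrow> 'm"
    and bind :: "'u set \<Rightarrow> 'u set \<Rightarrow> 'm \<Rightarrow> ('u \<Rightarrow> 'm) \<Rightarrow> 'm" +
  fixes A :: "'u set"
    and app :: "'u \<Rightarrow> 'u \<Rightarrow> 'm"  (infixl "\<cdot>" 70)
  assumes app_closed: "c\<^sub>f \<in> A \<Longrightarrow> c\<^sub>a \<in> A \<Longrightarrow> c\<^sub>f \<cdot> c\<^sub>a \<in> M A"
begin

text \<open>Call-by-value evaluation, only meaningful on the closed expressions \<open>exprs A 0\<close>.\<close>

primrec eval :: "'u expr \<Rightarrow> 'm" where
  "eval (Var i) = undefined"
| "eval (Code c) = unit A c"
| "eval (App e\<^sub>f e\<^sub>a) = bind A A (eval e\<^sub>f) (\<lambda>c\<^sub>f. bind A A (eval e\<^sub>a) (\<lambda>c\<^sub>a. c\<^sub>f \<cdot> c\<^sub>a))"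

end

text \<open>\<open>lam n e\<close> is the code \<open>\<langle>\<lambda>\<^sup>n. e\<rangle>\<close>, which abstracts the \<open>n + 1\<close> variables of \<open>e\<close>.\<close>

locale monadic_combinatory_algebra = monadic_applicative_structure M unit bind A app
  for M :: "'u set \<Rightarrow> 'm set"
    and unit :: "'u set \<Rightarrow> 'u \<Rightarrow> 'm"
    and bind :: "'u set \<Rightarrow> 'u set \<Rightarrow> 'm \<Rightarrow> ('u \<Rightarrow> 'm) \<Rightarrow> 'm"
    and A :: "'u set"
    and app :: "'u \<Rightarrow> 'u \<Rightarrow> 'm"  (infixl "\<cdot>" 70) +
  fixes lam :: "nat \<Rightarrow> 'u expr \<Rightarrow> 'u"
  assumes lam_closed: "e \<in> exprs A (Suc n) \<Longrightarrow> lam n e \<in> A"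
    and lam_0_app: "e \<in> exprs A (Suc 0) \<Longrightarrow> c \<in> A \<Longrightarrow> lam 0 e \<cdot> c = eval (subst e c)"
    and lam_Suc_app: "e \<in> exprs A (Suc (Suc n)) \<Longrightarrow> c \<in> A \<Longrightarrow>
      lam (Suc n) e \<cdot> c = unit A (lam n (subst e c))"
begin

lemma lam_Var_0_app: "c \<in> A \<Longrightarrow> lam 0 (Var 0) \<cdot> c = unit A c"
  by (simp add: lam_0_app exprs.intros)

definition combinatorially_complete :: "'u set \<Rightarrow> bool" where
  "combinatorially_complete S \<longleftrightarrow> S \<subseteq> A \<and> (\<forall>n. \<forall>e\<in>exprs S (Suc n). lam n e \<in> S)"

end


section \<open>Complete Heyting prealgebras\<close>

text \<open>Antisymmetry is not assumed. \<open>Meet\<close> selects a greatest lower bound of each subset; the binary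
  meet of \<open>x\<close> and \<open>y\<close> is \<open>Meet {x, y}\<close>.\<close>

locale complete_heyting_prealgebra =
  fixes le :: "'w \<Rightarrow> 'w \<Rightarrow> bool"  (infix "\<preceq>" 50)
    and Meet :: "'w set \<Rightarrow> 'w"
    and Top :: 'w
    and Bot :: 'w
    and imp :: "'w \<Rightarrow> 'w \<Rightarrow> 'w"  (infixr "\<rightharpoonup>" 60)
  assumes le_refl: "x \<preceq> x"
    and le_trans: "x \<preceq> y \<Longrightarrow> y \<preceq> z \<Longrightarrow> x \<preceq> z"
    and Meet_lower: "x \<in> W \<Longrightarrow> Meet W \<preceq> x"
    and Meet_greatest: "(\<And>x. x \<in> W \<Longrightarrow> z \<preceq> x) \<Longrightarrow> z \<preceq> Meet W"
    and le_Top: "x \<preceq> Top"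
    and Bot_le: "Bot \<preceq> x"
    and le_imp_iff: "x \<preceq> (y \<rightharpoonup> z) \<longleftrightarrow> Meet {x, y} \<preceq> z"


section \<open>Modalities\<close>

locale monad_modality =
  set_monad M unit bind + complete_heyting_prealgebra le Meet Top Bot imp
  for M :: "'u set \<Rightarrow> 'm set"
    and unit :: "'u set \<Rightarrow> 'u \<Rightarrow> 'm"
    and bind :: "'u set \<Rightarrow> 'u set \<Rightarrow> 'm \<Rightarrow> ('u \<Rightarrow> 'm) \<Rightarrow> 'm"
    and le :: "'w \<Rightarrow> 'w \<Rightarrow> bool"  (infix "\<preceq>" 50)
    and Meet :: "'w set \<Rightarrow> 'w"
    and Top :: 'w
    and Bot :: 'w
    and imp :: "'w \<Rightarrow> 'w \<Rightarrow> 'w"  (infixr "\<rightharpoonup>" 60) +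
  fixes dia :: "'u set \<Rightarrow> 'm \<Rightarrow> ('u \<Rightarrow> 'w) \<Rightarrow> 'w"  ("\<diamond>")
  assumes dia_cong: "m \<in> M X \<Longrightarrow> (\<And>x. x \<in> X \<Longrightarrow> \<phi> x = \<psi> x) \<Longrightarrow> \<diamond> X m \<phi> = \<diamond> X m \<psi>"
    and dia_natural: "m \<in> M X \<Longrightarrow> g \<in> X \<rightarrow> Y \<Longrightarrow>
      \<diamond> Y (fmap X Y g m) \<phi> = \<diamond> X m (\<lambda>x. \<phi> (g x))"
    and dia_unit: "a \<in> X \<Longrightarrow> \<phi> a \<preceq> \<diamond> X (unit X a) \<phi>"
    and dia_bind: "m \<in> M X \<Longrightarrow> f \<in> X \<rightarrow> M Y \<Longrightarrow>
      \<diamond> X m (\<lambda>x. \<diamond> Y (f x) \<phi>) \<preceq> \<diamond> Y (bind X Y m f) \<phi>"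
    and dia_mono: "m \<in> M X \<Longrightarrow>
      Meet ((\<lambda>c. \<phi>\<^sub>1 c \<rightharpoonup> \<phi>\<^sub>2 c) ` X) \<preceq> (\<diamond> X m \<phi>\<^sub>1 \<rightharpoonup> \<diamond> X m \<phi>\<^sub>2)"


section \<open>Monadic cores and their evidenced frames\<close>

text \<open>The data of an evidenced frame. Its axioms are not part of the record; for the frame induced by
  a monadic core they are a theorem.\<close>

record ('p, 'e) evidenced_frame =
  Prop :: "'p set"
  Evid :: "'e set"
  evidences :: "'p \<Rightarrow> 'e \<Rightarrow> 'p \<Rightarrow> bool"

locale monadic_core =
  monadic_combinatory_algebra M unit bind A app lam +
  monad_modality M unit bind le Meet Top Bot imp dia
  for M :: "'u set \<Rightarrow> 'm set"
    and unit :: "'u set \<Rightarrow> 'u \<Rightarrow> 'm"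
    and bind :: "'u set \<Rightarrow> 'u set \<Rightarrow> 'm \<Rightarrow> ('u \<Rightarrow> 'm) \<Rightarrow> 'm"
    and A :: "'u set"
    and app :: "'u \<Rightarrow> 'u \<Rightarrow> 'm"  (infixl "\<cdot>" 70)
    and lam :: "nat \<Rightarrow> 'u expr \<Rightarrow> 'u"
    and le :: "'w \<Rightarrow> 'w \<Rightarrow> bool"  (infix "\<preceq>" 50)
    and Meet :: "'w set \<Rightarrow> 'w"
    and Top :: 'w
    and Bot :: 'w
    and imp :: "'w \<Rightarrow> 'w \<Rightarrow> 'w"  (infixr "\<rightharpoonup>" 60)
    and dia :: "'u set \<Rightarrow> 'm \<Rightarrow> ('u \<Rightarrow> 'w) \<Rightarrow> 'w"  ("\<diamond>") +
  fixes S :: "'u set"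
  assumes separator_complete: "combinatorially_complete S"
    and separator_progress: "c\<^sub>f \<in> S \<Longrightarrow> c\<^sub>a \<in> S \<Longrightarrow> \<diamond> A (c\<^sub>f \<cdot> c\<^sub>a) (\<lambda>r. Bot) \<preceq> Bot"

text \<open>The function space \<open>\<Omega>\<^sup>A\<close> is rendered by extensional functions, so that propositions which
  agree on \<open>A\<close> are equal.\<close>

definition induced_frame ::
  "'u set \<Rightarrow> ('u \<Rightarrow> 'u \<Rightarrow> 'm) \<Rightarrow> ('w \<Rightarrow> 'w \<Rightarrow> bool) \<Rightarrow> ('u set \<Rightarrow> 'm \<Rightarrow> ('u \<Rightarrow> 'w) \<Rightarrow> 'w) \<Rightarrow>
    'u set \<Rightarrow> ('u \<Rightarrow> 'w, 'u) evidenced_frame" where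
  "induced_frame A app le dia S =
    \<lparr> Prop = A \<rightarrow>\<^sub>E UNIV,
      Evid = S,
      evidences = (\<lambda>\<phi>\<^sub>1 e \<phi>\<^sub>2. \<forall>c\<in>A. le (\<phi>\<^sub>1 c) (dia A (app e c) \<phi>\<^sub>2)) \<rparr>"

end

theory Submission imports Defs begin

text \<open>The separator contains the identity code \<open>i = \<langle>\<lambda>\<^sup>0. 0\<rangle>\<close>. If \<open>e\<close> is evidence of \<open>\<top> \<rightarrow> \<bottom>\<close>, then
  progress for \<open>e \<cdot> i\<close> gives \<open>\<one> \<le> \<diamond>(e \<cdot> i)(\<lambda>r. \<zero>) \<le> \<zero>\<close>. Conversely, if \<open>\<one> \<le> \<zero>\<close>, then \<open>i\<close> itself
  is evidence, by the unit law of the modality.\<close>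

theorem theorem3:
  fixes M :: "'u set \<Rightarrow> 'm set"
    and unit :: "'u set \<Rightarrow> 'u \<Rightarrow> 'm"
    and bind :: "'u set \<Rightarrow> 'u set \<Rightarrow> 'm \<Rightarrow> ('u \<Rightarrow> 'm) \<Rightarrow> 'm"
    and A :: "'u set"
    and app :: "'u \<Rightarrow> 'u \<Rightarrow> 'm"
    and lam :: "nat \<Rightarrow> 'u expr \<Rightarrow> 'u"
    and le :: "'w \<Rightarrow> 'w \<Rightarrow> bool"
    and Meet :: "'w set \<Rightarrow> 'w"
    and Top Bot :: 'w
    and imp :: "'w \<Rightarrow> 'w \<Rightarrow> 'w"
    and dia :: "'u set \<Rightarrow> 'm \<Rightarrow> ('u \<Rightarrow> 'w) \<Rightarrow> 'w"
    and S :: "'u set"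
  assumes "monadic_core M unit bind A app lam le Meet Top Bot imp dia S"
  shows "(\<exists>e\<in>Evid (induced_frame A app le dia S).
            evidences (induced_frame A app le dia S) (\<lambda>c\<in>A. Top) e (\<lambda>c\<in>A. Bot))
          \<longleftrightarrow> le Top Bot"
proof -
  interpret monadic_core M unit bind A app lam le Meet Top Bot imp dia S
    by (fact assms)
  define i where "i = lam 0 (Var 0)"
  have i_S: "i \<in> S"
    using separator_complete by (simp add: i_def combinatorially_complete_def exprs.intros)
  have S_A: "S \<subseteq> A"
    using separator_complete by (simp add: combinatorially_complete_def)
  \<comment> \<open>The frame's \<bottom> is extensional, so \<open>undefined\<close> off
    \<open>A\<close>; progress and the unit law are applied to the constant function.
    \<open>dia\<close> ignores values off \<open>A\<close>.\<close>
  have dia_Bot: "dia A (app e c) (\<lambda>c\<in>A. Bot) = dia A (app e c) (\<lambda>r. Bot)"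
    if "e \<in> S" "c \<in> A" for e c
    using that S_A by (intro dia_cong app_closed) auto
  show ?thesis
  proof
    assume "\<exists>e\<in>Evid (induced_frame A app le dia S).
      evidences (induced_frame A app le dia S) (\<lambda>c\<in>A. Top) e (\<lambda>c\<in>A. Bot)"
    then obtain e where e: "e \<in> S" "\<And>c. c \<in> A \<Longrightarrow> le Top (dia A (app e c) (\<lambda>r. Bot))"
      using dia_Bot by (auto simp: induced_frame_def)
    \<comment> \<open>Evidence works on all of \<open>A\<close>, but progress needs an argument in
      \<open>S\<close>; \<open>i\<close> serves as one.\<close>
    show "le Top Bot"
      using e(2)[of i] separator_progress[OF e(1) i_S] i_S S_A by (blast intro: le_trans)
  next
    assume "le Top Bot"
    \<comment> \<open>As \<open>app i c = unit A c\<close>, the chain is \<open>Top\<close> \<le>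
      \<open>Bot\<close> \<le> \<open>dia A (unit A c) (\<lambda>r. Bot)\<close>.\<close>
    then have "le Top (dia A (app i c) (\<lambda>r. Bot))" if "c \<in> A" for c
      using dia_unit[OF that, of "\<lambda>r. Bot"] lam_Var_0_app[OF that]
      by (metis i_def le_trans)
    then show "\<exists>e\<in>Evid (induced_frame A app le dia S).
      evidences (induced_frame A app le dia S) (\<lambda>c\<in>A. Top) e (\<lambda>c\<in>A. Bot)"
      using i_S dia_Bot by (auto simp: induced_frame_def intro!: bexI[of _ i])
  qed
qed

end
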